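(* Let $n\in\mathbb{N}$, $n\geq 1$. Let $A\in\mathbb{R}^{n\times n}$ and $B\in\mathbb{R}^{n\times 1}$ be in controller normal form, i.e. $$A=\begin{bmatrix}\begin{bmatrix}0_{(n-1)\times 1} & I_{n-1}\end{bmatrix}\\ A_n\end{bmatrix},\qquad B=\begin{bmatrix}0_{(n-1)\times 1}\\ B_n\end{bmatrix},$$ where the last row $A_n\in\mathbb{R}^{1\times n}$ of $A$ is arbitrary and $B_n\in\mathbb{R}$, $B_n\neq 0$. Let $K\in\mathbb{R}^{1\times n}$ be such that there exist symmetric positive definite matrices $P,Q\in\mathbb{R}^{n\times n}$ with $$(A+BK)^TP+P(A+BK)=-Q .$$ For $\sigma>0$ consider the linear time-invariant system with state $(x,\widehat x)\in\mathbb{R}^n\times\mathbb{R}^n$, $x=(x_1,\dots,x_n)$, $\widehat x=(\widehat x_1,\dots,\widehat x_n)$, given by $$\begin{cases}\dot x = Ax+BK\begin{bmatrix}\widehat x_1 & \widehat x_2 & \cdots & \widehat x_n\end{bmatrix}^T,\\ \dot{\widehat x}_1=-\sigma(\widehat x_1-x_1),\\ \dot{\widehat x}_i=-\sigma(\widehat x_i-\dot{\widehat x}_{i-1}),\quad i=2,\dots,n.\end{cases}$$ Then there exists $\underline\sigma\in\mathbb{R}_{>0}$ such that for every $\sigma\in(\underline\sigma,\infty)$ this system is asymptotically stable.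
   Context: The system is the closed loop of the plant $\dot x=Ax+Bu$ with measured output $y=x_1$ and the controller $u=K\widehat x$, where $\widehat x_1$ is a low-pass filtered version of $x_1$ and $\widehat x_2,\dots,\widehat x_n$ are the successive "dirty derivatives" that approximate the unmeasured states $x_2,\dots,x_n$. In the equation for $\dot{\widehat x}_i$ with $i\geq 2$, the symbol $\dot{\widehat x}_{i-1}$ denotes the right-hand side of the preceding differential equation (substituted recursively), so the system is an ordinary linear autonomous ODE on $\mathbb{R}^{2n}$. A linear time-invariant system is called asymptotically stable if its origin is asymptotically stable (equivalently, the origin is Lyapunov stable and every solution converges to $0$ as $t\to\infty$). $0_{p\times q}$ is the $p\times q$ zero matrix and $I_p$ the $p\times p$ identity matrix. The constant $\underline\sigma$ may depend on $n,A,B,K$. For $n=1$, $A=A_1$ and $B=B_1$ are scalars. *)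

theory Defs
  imports Complex_Main "Jordan_Normal_Form.Matrix"
begin

text \<open>Vectors and matrices are indexed from 0, so the informal component i + 1 of a vector \<open>v\<close>
  is \<open>v $ i\<close>. Row and column vectors in the informal matrix formulas are matrices with one row or
  column.\<close>

definition sym_pos_def :: "nat \<Rightarrow> real mat \<Rightarrow> bool" where
  "sym_pos_def n P \<longleftrightarrow> P \<in> carrier_mat n n \<and> P\<^sup>T = P \<and>
     (\<forall>v \<in> carrier_vec n. v \<noteq> 0\<^sub>v n \<longrightarrow> v \<bullet> (P *\<^sub>v v) > 0)"

text \<open>The \<open>four_block_mat\<close> with empty lower blocks is the block row
  \<open>[0 I]\<close> with \<open>n - 1\<close> rows and \<open>n\<close> columns; for \<open>n = 1\<close> it is empty and \<open>A\<close> is just its last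
  row \<open>An\<close>.\<close>

definition controller_normal_form :: "nat \<Rightarrow> real mat \<Rightarrow> real mat \<Rightarrow> bool" where
  "controller_normal_form n A B \<longleftrightarrow>
     (\<exists>An Bn. An \<in> carrier_mat 1 n \<and> Bn \<noteq> 0 \<and>
        A = four_block_mat (0\<^sub>m (n - 1) 1) (1\<^sub>m (n - 1)) (0\<^sub>m 0 1) (0\<^sub>m 0 (n - 1)) @\<^sub>r An \<and>
        B = 0\<^sub>m (n - 1) 1 @\<^sub>r mat 1 1 (\<lambda>_. Bn))"

text \<open>Right-hand side of the equation for the dirty derivative estimate with index \<open>i\<close>; the
  derivative of the preceding estimate is replaced by the right-hand side of its own equation.\<close>

fun dirty_derivative :: "real \<Rightarrow> real vec \<Rightarrow> real vec \<Rightarrow> nat \<Rightarrow> real" where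
  "dirty_derivative \<sigma> x xh 0 = - \<sigma> * (xh $ 0 - x $ 0)"
| "dirty_derivative \<sigma> x xh (Suc i) = - \<sigma> * (xh $ Suc i - dirty_derivative \<sigma> x xh i)"

text \<open>The state \<open>z\<close> of dimension \<open>2 * n\<close> is the concatenation of the plant state \<open>x\<close> and the
  estimate \<open>xh\<close>.\<close>

definition closed_loop ::
    "nat \<Rightarrow> real mat \<Rightarrow> real mat \<Rightarrow> real mat \<Rightarrow> real \<Rightarrow> real vec \<Rightarrow> real vec" where
  "closed_loop n A B K \<sigma> z =
     (let x = vec_first z n; xh = vec_last z n
      in (A *\<^sub>v x + (B * K) *\<^sub>v xh) @\<^sub>v vec n (dirty_derivative \<sigma> x xh))"

definition is_solution :: "nat \<Rightarrow> (real vec \<Rightarrow> real vec) \<Rightarrow> (real \<Rightarrow> real vec) \<Rightarrow> bool" where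
  "is_solution m f z \<longleftrightarrow>
     (\<forall>t\<ge>0. z t \<in> carrier_vec m \<and>
        (\<forall>i<m. ((\<lambda>s. z s $ i) has_real_derivative f (z t) $ i) (at t within {0..})))"

definition eucl_norm :: "real vec \<Rightarrow> real" where
  "eucl_norm v = sqrt (v \<bullet> v)"

text \<open>Asymptotic stability of the origin: Lyapunov stability together with convergence of every
  solution to 0. Attractivity is required globally; for the linear systems
  considered here this is the same as local attractivity, and every initial value has a solution
  on \<open>[0, \<infinity>)\<close>.\<close>

definition asymptotically_stable :: "nat \<Rightarrow> (real vec \<Rightarrow> real vec) \<Rightarrow> bool" where
  "asymptotically_stable m f \<longleftrightarrow>
     (\<forall>\<epsilon>>0. \<exists>\<delta>>0. \<forall>z. is_solution m f z \<and> eucl_norm (z 0) < \<delta> \<longrightarrow>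
        (\<forall>t\<ge>0. eucl_norm (z t) < \<epsilon>)) \<and>
     (\<forall>z. is_solution m f z \<longrightarrow> ((\<lambda>t. eucl_norm (z t)) \<longlongrightarrow> 0) at_top)"

end

theory Submission
  imports Defs "Jordan_Normal_Form.Schur_Decomposition"
begin

text \<open>A linear system is asymptotically stable once all eigenvalues of its matrix have negative real
  part: after Schur triangularization a suitably weighted sum of squares decays exponentially.
  For an eigenvalue \<open>s\<close> of the closed loop the eigenvector is a multiple of \<open>x\<^sub>i = s ^ i\<close>,
  \<open>xh\<^sub>i = s ^ i * H ^ (i + 1)\<close> with \<open>H = \<sigma> / (s + \<sigma>)\<close>, so that \<open>s\<close> is a root of the characteristic
  polynomial of \<open>A + B K\<close> with the gains multiplied by powers of \<open>H\<close>. If \<open>Re s \<ge> 0\<close>, then \<open>s\<close> is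
  bounded independently of \<open>\<sigma>\<close> and \<open>H\<close> is close to 1 for large \<open>\<sigma>\<close>, so the nominal characteristic
  polynomial is arbitrarily small at \<open>s\<close>; but it is Hurwitz by the Lyapunov equation and hence
  bounded away from 0 on the closed right half plane.\<close>

section \<open>Linear systems with a Hurwitz matrix\<close>

text \<open>Young's inequality, obtained by expanding the square of
  \<open>c * cmod v - d * cmod a * cmod w\<close>. The split charges only \<open>c / 2\<close> to
  \<open>v\<close>, so half of a damping rate \<open>c\<close> survives; the possibly large cost
  falls on \<open>w\<close>.\<close>

lemma weighted_cross_term_le:
  fixes v w a :: complex and c d :: real
  assumes "c > 0" "d \<ge> 0"
  shows "d * Re (cnj v * (a * w)) \<le> c / 2 * (cmod v)\<^sup>2 + (d * cmod a)\<^sup>2 / (2 * c) * (cmod w)\<^sup>2"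
proof -
  have "d * Re (cnj v * (a * w)) \<le> d * (cmod v * (cmod a * cmod w))"
    using complex_Re_le_cmod[of "cnj v * (a * w)"] assms(2)
    by (intro mult_left_mono) (auto simp: norm_mult)
  also have "\<dots> \<le> c / 2 * (cmod v)\<^sup>2 + (d * cmod a)\<^sup>2 / (2 * c) * (cmod w)\<^sup>2"
  proof -
    have "0 \<le> (c * cmod v - d * cmod a * cmod w)\<^sup>2 / (2 * c)"
      using assms(1) by simp
    also have "\<dots> = c / 2 * (cmod v)\<^sup>2 + (d * cmod a)\<^sup>2 / (2 * c) * (cmod w)\<^sup>2
        - d * (cmod v * (cmod a * cmod w))"
      using assms(1) by (simp add: field_simps power2_eq_square)
    finally show ?thesis by simp
  qed
  finally show ?thesis .
qed

text \<open>Completing the square absorbs the coupling into a new coordinate once its weight is large.\<close>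

lemma triangular_weighted_dissipation:
  fixes T :: "nat \<Rightarrow> nat \<Rightarrow> complex"
  assumes "\<And>i. i < N \<Longrightarrow> Re (T i i) < 0"
  shows "\<exists>d c. (\<forall>i. d i > 0) \<and> c > 0 \<and>
    (\<forall>w. (\<Sum>i<N. d i * Re (cnj (w i) * (\<Sum>j\<in>{i..<N}. T i j * w j))) \<le> - c * (\<Sum>i<N. (cmod (w i))\<^sup>2))"
  using assms
proof (induction N)
  case 0
  show ?case by (intro exI[of _ "\<lambda>_. 1"] exI[of _ 1]) simp
next
  case (Suc N)
  have "\<And>i. i < N \<Longrightarrow> Re (T i i) < 0" using Suc.prems by simp
  from Suc.IH[OF this] obtain d c where d: "\<And>i. d i > 0" and c: "c > 0"
    and dis: "\<And>w. (\<Sum>i<N. d i * Re (cnj (w i) * (\<Sum>j\<in>{i..<N}. T i j * w j))) \<le> - c * (\<Sum>i<N. (cmod (w i))\<^sup>2)"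
    by auto
  \<comment> \<open>\<open>L\<close> collects what the cross terms charge to the new coordinate
    \<open>w N\<close>. The weight \<open>e\<close> makes the damping of that coordinate pay for
    \<open>L\<close> and still leave the rate \<open>c / 2\<close> that the other coordinates
    retain.\<close>
  define L where "L = (\<Sum>i<N. (d i * cmod (T i N))\<^sup>2 / (2 * c))"
  define e where "e = (c / 2 + L) / (- Re (T N N))"
  have TN: "Re (T N N) < 0" using Suc.prems by simp
  have L: "L \<ge> 0" unfolding L_def using c by (intro sum_nonneg) auto
  have e: "e > 0" unfolding e_def using TN c L by (intro divide_pos_pos) auto
  have eT: "e * Re (T N N) = - (c / 2 + L)" unfolding e_def using TN by (simp add: field_simps)
  have "(\<Sum>i<Suc N. (d(N := e)) i * Re (cnj (w i) * (\<Sum>j\<in>{i..<Suc N}. T i j * w j)))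
      \<le> - (c / 2) * (\<Sum>i<Suc N. (cmod (w i))\<^sup>2)" for w :: "nat \<Rightarrow> complex"
  proof -
    have "(\<Sum>i<Suc N. (d(N := e)) i * Re (cnj (w i) * (\<Sum>j\<in>{i..<Suc N}. T i j * w j)))
      = (\<Sum>i<N. d i * Re (cnj (w i) * (\<Sum>j\<in>{i..<N}. T i j * w j)) + d i * Re (cnj (w i) * (T i N * w N)))
        + e * Re (cnj (w N) * (T N N * w N))"
      by (auto intro!: sum.cong simp: distrib_left)
    moreover have "e * Re (cnj (w N) * (T N N * w N)) = e * Re (T N N) * (cmod (w N))\<^sup>2"
      unfolding cmod_power2 by (simp add: algebra_simps power2_eq_square)
    moreover have "(\<Sum>i<N. d i * Re (cnj (w i) * (\<Sum>j\<in>{i..<N}. T i j * w j)) + d i * Re (cnj (w i) * (T i N * w N)))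
      \<le> - c * (\<Sum>i<N. (cmod (w i))\<^sup>2) +
        (\<Sum>i<N. c / 2 * (cmod (w i))\<^sup>2 + (d i * cmod (T i N))\<^sup>2 / (2 * c) * (cmod (w N))\<^sup>2)"
      unfolding sum.distrib[of "\<lambda>i. d i * Re (cnj (w i) * (\<Sum>j\<in>{i..<N}. T i j * w j))"]
      by (intro add_mono dis sum_mono weighted_cross_term_le c less_imp_le[OF d])
    moreover have "(\<Sum>i<N. c / 2 * (cmod (w i))\<^sup>2 + (d i * cmod (T i N))\<^sup>2 / (2 * c) * (cmod (w N))\<^sup>2)
      = c / 2 * (\<Sum>i<N. (cmod (w i))\<^sup>2) + L * (cmod (w N))\<^sup>2"
      by (simp only: L_def sum.distrib sum_distrib_left sum_distrib_right)
    ultimately have "(\<Sum>i<Suc N. (d(N := e)) i * Re (cnj (w i) * (\<Sum>j\<in>{i..<Suc N}. T i j * w j)))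
      \<le> - c * (\<Sum>i<N. (cmod (w i))\<^sup>2) + (c / 2 * (\<Sum>i<N. (cmod (w i))\<^sup>2) + L * (cmod (w N))\<^sup>2)
        + e * Re (T N N) * (cmod (w N))\<^sup>2"
      by linarith
    also have "\<dots> = - (c / 2) * (\<Sum>i<Suc N. (cmod (w i))\<^sup>2)"
      unfolding eT by (simp add: field_simps)
    finally show ?thesis .
  qed
  then show ?case using d e c
    by (intro exI[of _ "d(N := e)"] exI[of _ "c / 2"]) auto
qed

text \<open>A crude operator bound: every entry of \<open>v\<close> is at most the root of the whole
  sum of squares. It serves to compare norms before and after a change of basis. The summand 1 in
  \<open>C\<close> keeps the constant positive when \<open>R\<close> vanishes.\<close>

lemma linear_map_sum_squares_bound:
  fixes R :: "nat \<Rightarrow> nat \<Rightarrow> complex"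
  shows "\<exists>C>0. \<forall>v. (\<Sum>i<N. (cmod (\<Sum>k<N. R i k * v k))\<^sup>2) \<le> C * (\<Sum>k<N. (cmod (v k))\<^sup>2)"
proof -
  define C where "C = 1 + (\<Sum>i<N. (\<Sum>k<N. cmod (R i k))\<^sup>2)"
  have "C > 0" unfolding C_def by (intro add_pos_nonneg sum_nonneg) auto
  moreover have "(\<Sum>i<N. (cmod (\<Sum>k<N. R i k * v k))\<^sup>2) \<le> C * (\<Sum>k<N. (cmod (v k))\<^sup>2)" for v
  proof -
    define S where "S = (\<Sum>k<N. (cmod (v k))\<^sup>2)"
    have S: "S \<ge> 0" unfolding S_def by (intro sum_nonneg) auto
    have v: "cmod (v k) \<le> sqrt S" if "k < N" for k
      unfolding S_def using that by (intro real_le_rsqrt member_le_sum) auto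
    have "(cmod (\<Sum>k<N. R i k * v k))\<^sup>2 \<le> (\<Sum>k<N. cmod (R i k))\<^sup>2 * S" for i
    proof -
      have "cmod (\<Sum>k<N. R i k * v k) \<le> (\<Sum>k<N. cmod (R i k) * sqrt S)"
        by (intro sum_norm_le) (auto simp: norm_mult intro!: mult_left_mono v)
      then have "(cmod (\<Sum>k<N. R i k * v k))\<^sup>2 \<le> ((\<Sum>k<N. cmod (R i k)) * sqrt S)\<^sup>2"
        by (intro power_mono) (auto simp: sum_distrib_right)
      then show ?thesis using S by (simp add: power_mult_distrib)
    qed
    then have "(\<Sum>i<N. (cmod (\<Sum>k<N. R i k * v k))\<^sup>2) \<le> (\<Sum>i<N. (\<Sum>k<N. cmod (R i k))\<^sup>2 * S)"
      by (intro sum_mono)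
    also have "\<dots> \<le> C * S"
      unfolding C_def sum_distrib_right[symmetric] using S by (intro mult_right_mono) auto
    finally show ?thesis unfolding S_def .
  qed
  ultimately show ?thesis by blast
qed

section \<open>From exponential decay to asymptotic stability\<close>

text \<open>With the integrating factor \<open>exp (c * t)\<close> the product \<open>W\<close> is
  nonincreasing. Derivatives are taken within \<open>{0..}\<close>, as for solutions; at interior
  points they become two-sided via the open set \<open>{0<..}\<close>, and at 0 only continuity is
  used.\<close>

lemma exponential_decay:
  fixes V V' :: "real \<Rightarrow> real"
  assumes der: "\<And>t. t \<ge> 0 \<Longrightarrow> (V has_real_derivative V' t) (at t within {0..})"
    and le: "\<And>t. t \<ge> 0 \<Longrightarrow> V' t \<le> - c * V t"
    and t: "t \<ge> 0"
  shows "V t \<le> exp (- c * t) * V 0"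
proof -
  define W where "W s = exp (c * s) * V s" for s
  have W: "(W has_real_derivative exp (c * s) * (c * V s + V' s)) (at s within {0..})" if "s \<ge> 0" for s
    unfolding W_def by (auto intro!: derivative_eq_intros der that simp: algebra_simps)
  have "W t \<le> W 0"
  proof (rule DERIV_nonpos_imp_decreasing_open[of 0 t W])
    show "\<exists>y. (W has_real_derivative y) (at x) \<and> y \<le> 0" if "0 < x" "x < t" for x
    proof (intro exI conjI)
      have "(W has_real_derivative exp (c * x) * (c * V x + V' x)) (at x within {0<..})"
        using that by (intro DERIV_subset[OF W]) auto
      then show "(W has_real_derivative exp (c * x) * (c * V x + V' x)) (at x)"
        using that by (simp add: at_within_open[of x "{0<..}"])
      show "exp (c * x) * (c * V x + V' x) \<le> 0"
        using le[of x] that by (intro mult_nonneg_nonpos) auto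
    qed
    show "continuous_on {0..t} W"
      by (meson DERIV_continuous W atLeastAtMost_iff atLeast_iff continuous_on_eq_continuous_within
          continuous_on_subset subsetI)
  qed (rule t)
  then show ?thesis unfolding W_def by (simp add: exp_minus field_simps)
qed

lemma mult_mat_vec_index_sum:
  assumes "R \<in> carrier_mat m N" "v \<in> carrier_vec N" "i < m"
  shows "(R *\<^sub>v v) $ i = (\<Sum>k<N. R $$ (i, k) * v $ k)"
  using assms by (auto simp: scalar_prod_def atLeast0LessThan intro!: sum.cong)

lemma mult_mat_vec_sum_squares_bound:
  fixes R :: "complex mat"
  assumes R: "R \<in> carrier_mat N N"
  shows "\<exists>C>0. \<forall>v\<in>carrier_vec N. (\<Sum>i<N. (cmod ((R *\<^sub>v v) $ i))\<^sup>2) \<le> C * (\<Sum>k<N. (cmod (v $ k))\<^sup>2)"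
proof -
  obtain C where "C > 0"
    "\<And>v. (\<Sum>i<N. (cmod (\<Sum>k<N. R $$ (i, k) * v k))\<^sup>2) \<le> C * (\<Sum>k<N. (cmod (v k))\<^sup>2)"
    using linear_map_sum_squares_bound[of "\<lambda>i k. R $$ (i, k)" N] by blast
  then show ?thesis using R by (intro exI[of _ C]) (simp add: mult_mat_vec_index_sum del: index_mult_mat_vec)
qed

lemma eucl_norm_sqr:
  assumes "v \<in> carrier_vec N"
  shows "(eucl_norm v)\<^sup>2 = (\<Sum>i<N. (v $ i)\<^sup>2)"
proof -
  have "v \<bullet> v = (\<Sum>i<N. (v $ i)\<^sup>2)"
    using assms by (auto simp: scalar_prod_def atLeast0LessThan power2_eq_square)
  moreover have "(\<Sum>i<N. (v $ i)\<^sup>2) \<ge> 0" by (intro sum_nonneg) auto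
  ultimately show ?thesis by (simp add: eucl_norm_def)
qed

lemma eucl_norm_nonneg: "eucl_norm v \<ge> 0"
  unfolding eucl_norm_def scalar_prod_def by (intro real_sqrt_ge_zero sum_nonneg) auto

text \<open>One bound with constants common to all solutions yields both halves of the definition:
  estimating the exponential by 1 gives Lyapunov stability, and letting it tend to 0 gives
  attractivity.\<close>

lemma asymptotically_stable_if_exponential_bound:
  assumes C: "C > 0" and c: "c > 0"
    and bound: "\<And>z t. is_solution m f z \<Longrightarrow> t \<ge> 0 \<Longrightarrow>
      (eucl_norm (z t))\<^sup>2 \<le> C * exp (- c * t) * (eucl_norm (z 0))\<^sup>2"
  shows "asymptotically_stable m f"
  unfolding asymptotically_stable_def
proof (intro conjI allI impI)
  fix \<epsilon> :: real assume \<epsilon>: "\<epsilon> > 0"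
  show "\<exists>\<delta>>0. \<forall>z. is_solution m f z \<and> eucl_norm (z 0) < \<delta> \<longrightarrow> (\<forall>t\<ge>0. eucl_norm (z t) < \<epsilon>)"
  proof (intro exI[of _ "\<epsilon> / sqrt C"] conjI allI impI)
    show "\<epsilon> / sqrt C > 0" using \<epsilon> C by simp
    fix z and t :: real
    assume z: "is_solution m f z \<and> eucl_norm (z 0) < \<epsilon> / sqrt C" and t: "t \<ge> 0"
    have "(eucl_norm (z t))\<^sup>2 \<le> C * exp (- c * t) * (eucl_norm (z 0))\<^sup>2"
      using bound z t by blast
    also have "\<dots> \<le> C * 1 * (eucl_norm (z 0))\<^sup>2"
      using C c t by (intro mult_right_mono mult_left_mono) auto
    also have "\<dots> < C * 1 * (\<epsilon> / sqrt C)\<^sup>2"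
      using z C by (intro mult_strict_left_mono power_strict_mono) (auto simp: eucl_norm_nonneg)
    also have "\<dots> = \<epsilon>\<^sup>2" using C by (simp add: power_divide)
    finally show "eucl_norm (z t) < \<epsilon>" using \<epsilon> by (simp add: power_less_imp_less_base)
  qed
next
  fix z assume z: "is_solution m f z"
  have "((\<lambda>t. exp (- c * t)) \<longlongrightarrow> 0) at_top"
    using c by (intro filterlim_compose[OF exp_at_bot] filterlim_tendsto_neg_mult_at_bot[of _ "- c"]
        tendsto_const filterlim_ident) auto
  then have "((\<lambda>t. C * exp (- c * t) * (eucl_norm (z 0))\<^sup>2) \<longlongrightarrow> C * 0 * (eucl_norm (z 0))\<^sup>2) at_top"
    by (intro tendsto_intros)
  then have lim: "((\<lambda>t. C * exp (- c * t) * (eucl_norm (z 0))\<^sup>2) \<longlongrightarrow> 0) at_top" by simp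
  have "eventually (\<lambda>t. (eucl_norm (z t))\<^sup>2 \<le> C * exp (- c * t) * (eucl_norm (z 0))\<^sup>2) at_top"
    using eventually_ge_at_top[of 0] by eventually_elim (rule bound[OF z])
  then have "((\<lambda>t. (eucl_norm (z t))\<^sup>2) \<longlongrightarrow> 0) at_top"
    by (rule tendsto_sandwich[OF _ _ tendsto_const lim, rotated]) simp
  then show "((\<lambda>t. eucl_norm (z t)) \<longlongrightarrow> 0) at_top"
    using tendsto_real_sqrt[of "\<lambda>t. (eucl_norm (z t))\<^sup>2" 0 at_top] by (simp add: eucl_norm_nonneg)
qed

section \<open>Schur coordinates for a Hurwitz matrix\<close>

text \<open>Over the complex numbers the characteristic polynomial splits into linear factors, so
  the Schur decomposition applies; the diagonal of \<open>T\<close> lists the roots, which are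
  eigenvalues.\<close>

lemma complex_linear_schur:
  fixes A :: "complex mat"
  assumes A: "A \<in> carrier_mat N N"
  obtains T P Q where "T \<in> carrier_mat N N" "P \<in> carrier_mat N N" "Q \<in> carrier_mat N N"
    "P * Q = 1\<^sub>m N" "Q * P = 1\<^sub>m N" "A = P * T * Q" "upper_triangular T"
    "\<And>i. i < N \<Longrightarrow> eigenvalue A (T $$ (i, i))"
proof -
  from char_poly_factorized[OF A] obtain es
    where es: "char_poly A = (\<Prod>a\<leftarrow>es. [:- a, 1:])" by blast
  obtain T P Q where dec: "schur_decomposition A es = (T, P, Q)" by (metis prod_cases3)
  from schur_decomposition[OF A es dec]
  have sim: "similar_mat_wit A T P Q" and ut: "upper_triangular T" and diag: "diag_mat T = es" by auto
  note s = similar_mat_witD2[OF A sim]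
  have "eigenvalue A (T $$ (i, i))" if "i < N" for i
  proof -
    have "T $$ (i, i) \<in> set es"
      using that s(5) unfolding diag[symmetric] diag_mat_def by auto
    then show ?thesis
      unfolding eigenvalue_root_char_poly[OF A] es by (simp add: poly_prod_list prod_list_zero_iff image_iff)
  qed
  with s ut that show thesis by blast
qed

text \<open>In the coordinates \<open>w = Q z\<close> the system matrix becomes the triangular
  \<open>T\<close>, and the weighted sum of squares \<open>V\<close> is a Lyapunov function. Its
  decay is an a priori estimate for an arbitrary solution, carried back to \<open>z\<close> by the
  bounds for \<open>P\<close> and \<open>Q\<close>.\<close>

lemma hurwitz_imp_asymptotically_stable:
  fixes M :: "real mat"
  assumes M: "M \<in> carrier_mat N N"
    and hurwitz: "\<And>s. eigenvalue (map_mat complex_of_real M) s \<Longrightarrow> Re s < 0"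
  shows "asymptotically_stable N (\<lambda>z. M *\<^sub>v z)"
proof -
  define A where "A = map_mat complex_of_real M"
  have A: "A \<in> carrier_mat N N" using M by (simp add: A_def)
  obtain T P Q where T: "T \<in> carrier_mat N N" and P: "P \<in> carrier_mat N N" and Q: "Q \<in> carrier_mat N N"
    and PQ: "P * Q = 1\<^sub>m N" and QP: "Q * P = 1\<^sub>m N" and APTQ: "A = P * T * Q"
    and ut: "upper_triangular T" and ev: "\<And>i. i < N \<Longrightarrow> eigenvalue A (T $$ (i, i))"
    using complex_linear_schur[OF A] by metis
  obtain d c where d: "\<And>i. d i > 0" and c: "c > 0"
    and dis: "\<And>w. (\<Sum>i<N. d i * Re (cnj (w i) * (\<Sum>j\<in>{i..<N}. T $$ (i, j) * w j)))
        \<le> - c * (\<Sum>i<N. (cmod (w i))\<^sup>2)"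
    using triangular_weighted_dissipation[of N "\<lambda>i j. T $$ (i, j)"] ev hurwitz
    unfolding A_def by auto
  obtain CP where CP: "CP > 0"
    "\<And>v. v \<in> carrier_vec N \<Longrightarrow> (\<Sum>i<N. (cmod ((P *\<^sub>v v) $ i))\<^sup>2) \<le> CP * (\<Sum>k<N. (cmod (v $ k))\<^sup>2)"
    using mult_mat_vec_sum_squares_bound[OF P] by blast
  obtain CQ where CQ: "CQ > 0"
    "\<And>v. v \<in> carrier_vec N \<Longrightarrow> (\<Sum>i<N. (cmod ((Q *\<^sub>v v) $ i))\<^sup>2) \<le> CQ * (\<Sum>k<N. (cmod (v $ k))\<^sup>2)"
    using mult_mat_vec_sum_squares_bound[OF Q] by blast
  \<comment> \<open>\<open>e\<close> and \<open>D\<close> bound the weights from below and above,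
    making \<open>V\<close> comparable to the squared norm of \<open>w\<close>. For
    \<open>N = 0\<close> the minimum would range over the empty set, so \<open>e\<close> is then
    1.\<close>
  define D where "D = 1 + (\<Sum>i<N. d i)"
  have D: "D > 0" unfolding D_def using d by (intro add_pos_nonneg sum_nonneg) (auto intro: less_imp_le)
  have dD: "d i \<le> D" if "i < N" for i
    using member_le_sum[of i "{..<N}" d] less_imp_le[OF d] that unfolding D_def by force
  obtain e where e: "e > 0" and ed: "\<And>i. i < N \<Longrightarrow> e \<le> d i"
  proof (cases "N = 0")
    case False
    show thesis
      using False d by (intro that[of "Min (d ` {..<N})"]) (auto simp: lessThan_empty_iff)
  qed (use that[of 1] in auto)
  show ?thesis
  proof (rule asymptotically_stable_if_exponential_bound)
    \<comment> \<open>The factors come from four comparisons: \<open>z t\<close> with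
      \<open>w t\<close>, \<open>w t\<close> with \<open>V t\<close>, \<open>V 0\<close> with
      \<open>w 0\<close>, and \<open>w 0\<close> with \<open>z 0\<close>.\<close>
    show "CP * (1 / e) * D * CQ > 0" using CP CQ D e by simp
    show "2 * c / D > 0" using c D by simp
    fix z :: "real \<Rightarrow> real vec" and t :: real
    assume sol: "is_solution N ((*\<^sub>v) M) z" and t: "t \<ge> 0"
    define w where "w t = Q *\<^sub>v map_vec complex_of_real (z t)" for t
    define V where "V t = (\<Sum>i<N. d i * ((Re (w t $ i))\<^sup>2 + (Im (w t $ i))\<^sup>2))" for t
    have z: "z t \<in> carrier_vec N" if "t \<ge> 0" for t
      using sol that by (simp add: is_solution_def)
    have w: "w t \<in> carrier_vec N" for t unfolding w_def using Q by (intro carrier_vecI) simp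
    have wi: "w t $ i = (\<Sum>k<N. Q $$ (i, k) * complex_of_real (z t $ k))" if "t \<ge> 0" "i < N" for t i
      unfolding w_def using z[OF that(1)] that(2) Q by (subst mult_mat_vec_index_sum[of _ N N]) auto
    \<comment> \<open>This is \<open>Q * A = T * Q\<close>, with the row sum cut to
      \<open>j \<ge> i\<close> by triangularity to match the form of \<open>dis\<close>.\<close>
    have Tw: "(\<Sum>k<N. Q $$ (i, k) * complex_of_real ((M *\<^sub>v z t) $ k)) = (\<Sum>j\<in>{i..<N}. T $$ (i, j) * w t $ j)"
      if t: "t \<ge> 0" and i: "i < N" for t i
    proof -
      have "map_vec complex_of_real (M *\<^sub>v z t) = A *\<^sub>v map_vec complex_of_real (z t)"
        unfolding A_def by (rule of_real_hom.mult_mat_vec_hom[OF M z[OF t]])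
      then have "Q *\<^sub>v map_vec complex_of_real (M *\<^sub>v z t) = Q *\<^sub>v ((P * T * Q) *\<^sub>v map_vec complex_of_real (z t))"
        by (simp add: APTQ)
      also have "\<dots> = (Q * (P * T * Q)) *\<^sub>v map_vec complex_of_real (z t)"
        using P T Q z[OF t] by (intro assoc_mult_mat_vec[symmetric]) auto
      also have "Q * (P * T * Q) = Q * P * (T * Q)"
        using P T Q by (simp add: assoc_mult_mat[of _ N N _ N _ N])
      also have "\<dots> = T * Q" using T Q by (simp add: QP)
      also have "(T * Q) *\<^sub>v map_vec complex_of_real (z t) = T *\<^sub>v w t"
        unfolding w_def using T Q z[OF t] by (intro assoc_mult_mat_vec) auto
      finally have eq: "(Q *\<^sub>v map_vec complex_of_real (M *\<^sub>v z t)) $ i = (T *\<^sub>v w t) $ i" by simp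
      have "(Q *\<^sub>v map_vec complex_of_real (M *\<^sub>v z t)) $ i
          = (\<Sum>k<N. Q $$ (i, k) * complex_of_real ((M *\<^sub>v z t) $ k))"
        using z[OF t] i Q M by (subst mult_mat_vec_index_sum[of _ N N]) auto
      moreover have "(T *\<^sub>v w t) $ i = (\<Sum>j<N. T $$ (i, j) * w t $ j)"
        by (rule mult_mat_vec_index_sum[OF T w i])
      moreover have "\<dots> = (\<Sum>j\<in>{i..<N}. T $$ (i, j) * w t $ j)"
        using ut T i by (intro sum.mono_neutral_right) (auto simp: upper_triangular_def)
      ultimately show ?thesis using eq by simp
    qed
    have V: "(V has_real_derivative 2 * (\<Sum>i<N. d i * Re (cnj (w t $ i) * (\<Sum>j\<in>{i..<N}. T $$ (i, j) * w t $ j))))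
        (at t within {0..})" if t: "t \<ge> 0" for t
    proof -
      \<comment> \<open>The expansion of \<open>w\<close> into components is available only for
        nonnegative times, where \<open>z\<close> has dimension \<open>N\<close>. Hence the explicit
        sum \<open>W\<close> is differentiated and the derivative is transferred to \<open>V\<close>
        within \<open>{0..}\<close>.\<close>
      define u where "u i s = (\<Sum>k<N. Q $$ (i, k) * complex_of_real (z s $ k))" for i s
      define W where "W s = (\<Sum>i<N. d i * ((Re (u i s))\<^sup>2 + (Im (u i s))\<^sup>2))" for s
      have dz: "((\<lambda>s. z s $ k) has_real_derivative (M *\<^sub>v z t) $ k) (at t within {0..})" if "k < N" for k
        using sol t that by (simp add: is_solution_def)
      define X where "X i = (\<Sum>k<N. Q $$ (i, k) * complex_of_real ((M *\<^sub>v z t) $ k))" for i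
      have du: "((\<lambda>s. Re (u i s)) has_real_derivative Re (X i)) (at t within {0..})"
        "((\<lambda>s. Im (u i s)) has_real_derivative Im (X i)) (at t within {0..})" for i
        unfolding u_def X_def
        by (auto intro!: derivative_eq_intros dz sum.cong simp: mult.commute simp del: index_mult_mat_vec)
      have sq: "((\<lambda>s. r * ((f s)\<^sup>2 + (g s)\<^sup>2)) has_real_derivative 2 * (r * (f t * f' + g t * g'))) (at t within {0..})"
        if "(f has_real_derivative f') (at t within {0..})" "(g has_real_derivative g') (at t within {0..})"
        for f g :: "real \<Rightarrow> real" and f' g' r
        by (auto intro!: derivative_eq_intros that simp: algebra_simps)
      have term_der: "((\<lambda>s. d i * ((Re (u i s))\<^sup>2 + (Im (u i s))\<^sup>2)) has_real_derivative
          2 * (d i * Re (cnj (u i t) * X i))) (at t within {0..})" for i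
        using sq[OF du] by simp
      have "(W has_real_derivative (\<Sum>i<N. 2 * (d i * Re (cnj (u i t) * X i)))) (at t within {0..})"
        unfolding W_def by (intro DERIV_sum term_der)
      also have "(\<Sum>i<N. 2 * (d i * Re (cnj (u i t) * X i)))
          = 2 * (\<Sum>i<N. d i * Re (cnj (w t $ i) * (\<Sum>j\<in>{i..<N}. T $$ (i, j) * w t $ j)))"
        unfolding sum_distrib_left[of 2] X_def u_def by (intro sum.cong refl) (simp only: Tw[OF t] wi[OF t] lessThan_iff)
      finally have W: "(W has_real_derivative 2 * (\<Sum>i<N. d i * Re (cnj (w t $ i) * (\<Sum>j\<in>{i..<N}. T $$ (i, j) * w t $ j))))
        (at t within {0..})" .
      have WV: "W s = V s" if "s \<ge> 0" for s
        unfolding V_def W_def u_def using wi[OF that] by (intro sum.cong) auto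
      show ?thesis
      proof (rule has_field_derivative_transform_within[where f = W and d = 1])
        show "W s = V s" if "s \<in> {0..}" for s using WV that by simp
      qed (use t W in \<open>simp_all only: atLeast_iff zero_less_one\<close>)
    qed
    have Vle: "V t \<le> D * (\<Sum>i<N. (cmod (w t $ i))\<^sup>2)" for t
      unfolding V_def sum_distrib_left cmod_power2 using dD by (intro sum_mono mult_right_mono) auto
    have leV: "(\<Sum>i<N. (cmod (w t $ i))\<^sup>2) \<le> 1 / e * V t" for t
    proof -
      have "e * (\<Sum>i<N. (cmod (w t $ i))\<^sup>2) \<le> V t"
        unfolding V_def sum_distrib_left cmod_power2 using ed by (intro sum_mono mult_right_mono) auto
      then show ?thesis using e by (simp add: field_simps)
    qed
    have decay: "V t \<le> exp (- (2 * c / D) * t) * V 0"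
    proof (rule exponential_decay[OF V _ t])
      fix t :: real
      have "2 * (\<Sum>i<N. d i * Re (cnj (w t $ i) * (\<Sum>j\<in>{i..<N}. T $$ (i, j) * w t $ j)))
        \<le> 2 * (- c * (\<Sum>i<N. (cmod (w t $ i))\<^sup>2))"
        by (intro mult_left_mono dis) auto
      also have "\<dots> = - (2 * c / D) * (D * (\<Sum>i<N. (cmod (w t $ i))\<^sup>2))" using D by simp
      also have "\<dots> \<le> - (2 * c / D) * V t"
        using Vle c D by (intro mult_left_mono_neg) auto
      finally show "2 * (\<Sum>i<N. d i * Re (cnj (w t $ i) * (\<Sum>j\<in>{i..<N}. T $$ (i, j) * w t $ j)))
        \<le> - (2 * c / D) * V t" .
    qed
    have norm_eq: "(eucl_norm (z t))\<^sup>2 = (\<Sum>k<N. (cmod (map_vec complex_of_real (z t) $ k))\<^sup>2)" if "t \<ge> 0" for t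
      using z[OF that] by (simp add: eucl_norm_sqr)
    have Pw: "map_vec complex_of_real (z t) = P *\<^sub>v w t"
    proof -
      have "P *\<^sub>v w t = (P * Q) *\<^sub>v map_vec complex_of_real (z t)"
        unfolding w_def using P Q z[OF t] by (intro assoc_mult_mat_vec[symmetric]) auto
      then show ?thesis using z[OF t] by (simp add: PQ)
    qed
    have w0: "(\<Sum>i<N. (cmod (w 0 $ i))\<^sup>2) \<le> CQ * (eucl_norm (z 0))\<^sup>2"
      unfolding norm_eq[OF order_refl] unfolding w_def using z[of 0] by (intro CQ(2)) auto
    have "(eucl_norm (z t))\<^sup>2 \<le> CP * (\<Sum>i<N. (cmod (w t $ i))\<^sup>2)"
      unfolding norm_eq[OF t] Pw by (rule CP(2)[OF w])
    also have "\<dots> \<le> CP * (1 / e * V t)"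
      using CP(1) by (intro mult_left_mono leV) simp
    also have "\<dots> \<le> CP * (1 / e * (exp (- (2 * c / D) * t) * V 0))"
      using CP(1) e by (intro mult_left_mono decay) simp_all
    also have "\<dots> \<le> CP * (1 / e * (exp (- (2 * c / D) * t) * (D * (\<Sum>i<N. (cmod (w 0 $ i))\<^sup>2))))"
      using CP(1) e by (intro mult_left_mono Vle) simp_all
    also have "\<dots> \<le> CP * (1 / e * (exp (- (2 * c / D) * t) * (D * (CQ * (eucl_norm (z 0))\<^sup>2))))"
      using CP(1) e D by (intro mult_left_mono w0) simp_all
    finally show "(eucl_norm (z t))\<^sup>2 \<le> CP * (1 / e) * D * CQ * exp (- (2 * c / D) * t) * (eucl_norm (z 0))\<^sup>2"
      by (simp add: mult_ac)
  qed
qed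

section \<open>Hurwitz polynomials and the Lyapunov equation\<close>

text \<open>Factor \<open>p\<close> over its roots. For \<open>Re s \<ge> 0\<close> each factor
  satisfies \<open>cmod (s - a) \<ge> Re s - Re a \<ge> - Re a > 0\<close>, a bound independent of
  \<open>s\<close>, so no compactness argument is involved.\<close>

lemma poly_bounded_below_right_half_plane:
  fixes p :: "complex poly"
  assumes "p \<noteq> 0" and roots: "\<And>s. poly p s = 0 \<Longrightarrow> Re s < 0"
  shows "\<exists>m>0. \<forall>s. Re s \<ge> 0 \<longrightarrow> m \<le> cmod (poly p s)"
proof -
  obtain as where as: "smult (lead_coeff p) (\<Prod>a\<leftarrow>as. [:- a, 1:]) = p"
    using fundamental_theorem_algebra_factorized by blast
  have poly_p: "poly p s = lead_coeff p * (\<Prod>a\<leftarrow>as. s - a)" for s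
    by (subst as[symmetric]) (simp add: poly_prod_list o_def)
  have "Re a < 0" if "a \<in> set as" for a
    using that by (intro roots) (auto simp: poly_p prod_list_zero_iff)
  then have "\<exists>m>0. \<forall>s. Re s \<ge> 0 \<longrightarrow> m \<le> cmod (\<Prod>a\<leftarrow>as. s - a)"
  proof (induction as)
    case Nil
    show ?case by (intro exI[of _ 1]) simp
  next
    case (Cons a as)
    then obtain m where m: "m > 0" "\<And>s. Re s \<ge> 0 \<Longrightarrow> m \<le> cmod (\<Prod>a\<leftarrow>as. s - a)" by auto
    have a: "Re a < 0" using Cons.prems by simp
    have "- Re a * m \<le> cmod (s - a) * cmod (\<Prod>a\<leftarrow>as. s - a)" if "Re s \<ge> 0" for s
      using m(1) m(2)[OF that] that complex_Re_le_cmod[of "s - a"] a by (intro mult_mono) auto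
    then show ?case using a m(1)
      by (intro exI[of _ "- Re a * m"]) (auto simp: norm_mult mult_neg_pos)
  qed
  then obtain m where m: "m > 0" "\<And>s. Re s \<ge> 0 \<Longrightarrow> m \<le> cmod (\<Prod>a\<leftarrow>as. s - a)" by blast
  show ?thesis using assms(1) m
    by (intro exI[of _ "cmod (lead_coeff p) * m"]) (auto simp: poly_p norm_mult)
qed

text \<open>Definiteness speaks of real vectors, so the eigenvector is split into its real and
  imaginary parts \<open>p\<close> and \<open>q\<close>. Adding the Lyapunov identities for
  \<open>p\<close> and \<open>q\<close> cancels the \<open>Im s\<close> terms by symmetry of
  \<open>P\<close>; what remains is \<open>2 * Re s\<close> times a positive number equal to a
  negative one.\<close>

lemma lyapunov_equation_imp_hurwitz:
  assumes F: "F \<in> carrier_mat n n" and P: "sym_pos_def n P" and Q: "sym_pos_def n Q"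
    and lyap: "F\<^sup>T * P + P * F = - Q"
    and ev: "eigenvalue (map_mat complex_of_real F) s"
  shows "Re s < 0"
proof -
  have Pc: "P \<in> carrier_mat n n" and Psym: "P\<^sup>T = P"
    using P by (auto simp: sym_pos_def_def)
  have Qc: "Q \<in> carrier_mat n n"
    using Q by (auto simp: sym_pos_def_def)
  obtain v where v: "v \<in> carrier_vec n" "v \<noteq> 0\<^sub>v n" and Fv: "map_mat complex_of_real F *\<^sub>v v = s \<cdot>\<^sub>v v"
    using ev F by (auto simp: eigenvalue_def eigenvector_def)
  define p q where "p = map_vec Re v" and "q = map_vec Im v"
  have pc: "p \<in> carrier_vec n" and qc: "q \<in> carrier_vec n" using v by (auto simp: p_def q_def)
  have Fvi: "(\<Sum>k<n. complex_of_real (F $$ (i, k)) * v $ k) = s * v $ i" if "i < n" for i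
    using arg_cong[OF Fv, of "\<lambda>u. u $ i"] that v F
    by (auto simp: scalar_prod_def atLeast0LessThan)
  have Fp: "F *\<^sub>v p = Re s \<cdot>\<^sub>v p - Im s \<cdot>\<^sub>v q"
  proof (rule eq_vecI)
    fix i assume "i < dim_vec (Re s \<cdot>\<^sub>v p - Im s \<cdot>\<^sub>v q)"
    then have i: "i < n" using qc by simp
    then show "(F *\<^sub>v p) $ i = (Re s \<cdot>\<^sub>v p - Im s \<cdot>\<^sub>v q) $ i"
      using arg_cong[OF Fvi[OF i], of Re] F v
      by (simp add: p_def q_def scalar_prod_def atLeast0LessThan)
  qed (use F qc in auto)
  have Fq: "F *\<^sub>v q = Im s \<cdot>\<^sub>v p + Re s \<cdot>\<^sub>v q"
  proof (rule eq_vecI)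
    fix i assume "i < dim_vec (Im s \<cdot>\<^sub>v p + Re s \<cdot>\<^sub>v q)"
    then have i: "i < n" using qc by simp
    then show "(F *\<^sub>v q) $ i = (Im s \<cdot>\<^sub>v p + Re s \<cdot>\<^sub>v q) $ i"
      using arg_cong[OF Fvi[OF i], of Im] F v
      by (simp add: p_def q_def scalar_prod_def atLeast0LessThan)
  qed (use F qc in auto)
  have sym: "u \<bullet> (P *\<^sub>v w) = w \<bullet> (P *\<^sub>v u)" if "u \<in> carrier_vec n" "w \<in> carrier_vec n" for u w
    using transpose_vec_mult_scalar[OF Pc that(1) that(2)] Psym
      comm_scalar_prod[of "P *\<^sub>v w" n u] that Pc by simp
  have form: "2 * ((F *\<^sub>v u) \<bullet> (P *\<^sub>v u)) = - (u \<bullet> (Q *\<^sub>v u))" if u: "u \<in> carrier_vec n" for u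
  proof -
    have "- (u \<bullet> (Q *\<^sub>v u)) = u \<bullet> ((- Q) *\<^sub>v u)"
      using u Qc by (simp add: uminus_mult_mat_vec)
    also have "\<dots> = u \<bullet> (F\<^sup>T *\<^sub>v (P *\<^sub>v u) + P *\<^sub>v (F *\<^sub>v u))"
      unfolding lyap[symmetric] using F Pc u
      by (subst add_mult_distrib_mat_vec[of _ n n]) auto
    also have "\<dots> = u \<bullet> (F\<^sup>T *\<^sub>v (P *\<^sub>v u)) + u \<bullet> (P *\<^sub>v (F *\<^sub>v u))"
      using F Pc u by (intro scalar_prod_add_distrib) auto
    also have "u \<bullet> (P *\<^sub>v (F *\<^sub>v u)) = (F *\<^sub>v u) \<bullet> (P *\<^sub>v u)"
      using F u by (intro sym) auto
    also have "u \<bullet> (F\<^sup>T *\<^sub>v (P *\<^sub>v u)) = (F\<^sup>T *\<^sub>v (P *\<^sub>v u)) \<bullet> u"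
      using F Pc u by (intro comm_scalar_prod[of _ n]) auto
    also have "\<dots> = (P *\<^sub>v u) \<bullet> (F *\<^sub>v u)"
      using F Pc u by (intro transpose_vec_mult_scalar) auto
    also have "\<dots> = (F *\<^sub>v u) \<bullet> (P *\<^sub>v u)"
      using F Pc u by (intro comm_scalar_prod[of _ n]) auto
    finally show ?thesis by simp
  qed
  have "(F *\<^sub>v p) \<bullet> (P *\<^sub>v p) = Re s * (p \<bullet> (P *\<^sub>v p)) - Im s * (q \<bullet> (P *\<^sub>v p))"
    unfolding Fp using pc qc Pc by (simp add: minus_scalar_prod_distrib[of _ n])
  moreover have "(F *\<^sub>v q) \<bullet> (P *\<^sub>v q) = Im s * (q \<bullet> (P *\<^sub>v p)) + Re s * (q \<bullet> (P *\<^sub>v q))"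
    unfolding Fq using pc qc Pc sym[OF pc qc] by (simp add: add_scalar_prod_distrib[of _ n])
  ultimately have eq: "2 * Re s * (p \<bullet> (P *\<^sub>v p) + q \<bullet> (P *\<^sub>v q)) = - (p \<bullet> (Q *\<^sub>v p) + q \<bullet> (Q *\<^sub>v q))"
    using form[OF pc] form[OF qc] by (simp add: algebra_simps)
  \<comment> \<open>One of the two parts may vanish, for instance for a real eigenvector, so
    positivity is claimed only for the sum of the two quadratic forms.\<close>
  have pq: "p \<noteq> 0\<^sub>v n \<or> q \<noteq> 0\<^sub>v n"
  proof (rule ccontr)
    assume "\<not> ?thesis"
    then have 0: "p = 0\<^sub>v n" "q = 0\<^sub>v n" by auto
    have vi: "v $ i = 0" if "i < n" for i
    proof -
      have "p $ i = 0" "q $ i = 0" using 0 that by simp_all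
      then show ?thesis using that v(1) by (simp add: p_def q_def complex_eq_iff)
    qed
    have "v = 0\<^sub>v n" using v(1) vi by (intro eq_vecI) auto
    then show False using v(2) by simp
  qed
  have pos: "p \<bullet> (R *\<^sub>v p) + q \<bullet> (R *\<^sub>v q) > 0" if R: "sym_pos_def n R" for R
  proof -
    have Rc: "R \<in> carrier_mat n n" and Rpos: "\<And>v. v \<in> carrier_vec n \<Longrightarrow> v \<noteq> 0\<^sub>v n \<Longrightarrow> v \<bullet> (R *\<^sub>v v) > 0"
      using R by (auto simp: sym_pos_def_def)
    have "u \<bullet> (R *\<^sub>v u) \<ge> 0" if "u \<in> carrier_vec n" for u
      using Rpos[OF that] Rc by (cases "u = 0\<^sub>v n") auto
    then show ?thesis
      using pq Rpos[OF pc] Rpos[OF qc] pc qc by (auto intro: add_nonneg_pos add_pos_nonneg)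
  qed
  show ?thesis
  proof (rule ccontr)
    assume "\<not> ?thesis"
    then have "2 * Re s * (p \<bullet> (P *\<^sub>v p) + q \<bullet> (P *\<^sub>v q)) \<ge> 0" using pos[OF P] by simp
    then show False using eq pos[OF Q] by simp
  qed
qed

section \<open>The closed loop\<close>

text \<open>A Cauchy bound: if \<open>cmod s > 1\<close>, every lower power of \<open>s\<close> is
  at most \<open>cmod s ^ (n - 1)\<close> in modulus, which can then be divided out. Bounding the
  coefficients only by \<open>M\<close> makes the estimate uniform in \<open>\<sigma>\<close>
  later.\<close>

lemma root_of_monic_norm_le:
  fixes c :: "nat \<Rightarrow> complex"
  assumes "n \<ge> 1" and root: "s ^ n = (\<Sum>j<n. c j * s ^ j)"
    and le: "\<And>j. j < n \<Longrightarrow> cmod (c j) \<le> M j"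
  shows "cmod s \<le> 1 + (\<Sum>j<n. M j)"
proof -
  have M: "0 \<le> (\<Sum>j<n. M j)" using le by (intro sum_nonneg) (force intro: order_trans[OF norm_ge_zero])
  show ?thesis
  proof (cases "cmod s \<le> 1")
    case False
    have "cmod s * cmod s ^ (n - 1) = cmod (s ^ n)"
      using assms(1) by (simp add: norm_power flip: power_Suc)
    also have "\<dots> \<le> (\<Sum>j<n. M j * cmod s ^ (n - 1))"
      unfolding root
    proof (intro sum_norm_le)
      fix j assume j: "j \<in> {..<n}"
      show "cmod (c j * s ^ j) \<le> M j * cmod s ^ (n - 1)"
        unfolding norm_mult norm_power using j False le[of j]
        by (intro mult_mono power_increasing) (auto intro: order_trans[OF norm_ge_zero])
    qed
    finally have "cmod s * cmod s ^ (n - 1) \<le> (\<Sum>j<n. M j) * cmod s ^ (n - 1)"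
      unfolding sum_distrib_right .
    moreover have "cmod s ^ (n - 1) > 0" using False by (intro zero_less_power) linarith
    ultimately have "cmod s \<le> (\<Sum>j<n. M j)" by (rule mult_right_le_imp_le)
    then show ?thesis by simp
  qed (use M in simp)
qed

lemma filtered_characteristic_equation_stable:
  fixes a c :: "nat \<Rightarrow> complex"
  assumes "n \<ge> 1"
    and roots: "\<And>s. s ^ n = (\<Sum>j<n. (a j + c j) * s ^ j) \<Longrightarrow> Re s < 0"
  shows "\<exists>\<sigma>\<^sub>0>0. \<forall>\<sigma>>\<sigma>\<^sub>0. \<forall>s.
    s ^ n = (\<Sum>j<n. (a j + c j * (of_real \<sigma> / (s + of_real \<sigma>)) ^ Suc j) * s ^ j) \<longrightarrow> Re s < 0"
proof -
  define p where "p = monom 1 n - (\<Sum>j<n. monom (a j + c j) j)"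
  have poly_p: "poly p s = s ^ n - (\<Sum>j<n. (a j + c j) * s ^ j)" for s
    by (simp add: p_def poly_monom poly_sum)
  have "coeff p n = 1"
    by (simp add: p_def coeff_sum sum.neutral)
  then have "p \<noteq> 0" by auto
  then obtain m where m: "m > 0" "\<And>s. Re s \<ge> 0 \<Longrightarrow> m \<le> cmod (poly p s)"
    using poly_bounded_below_right_half_plane[of p] roots by (auto simp: poly_p)
  \<comment> \<open>\<open>R\<close> will bound every filtered root with
    \<open>Re s \<ge> 0\<close>, whatever \<open>\<sigma>\<close> is, and
    \<open>L / \<sigma>\<close> will bound \<open>p\<close> there. Thus
    \<open>\<sigma> > L / m\<close> contradicts the lower bound \<open>m\<close>; the extra 1 keeps
    the threshold positive if \<open>L = 0\<close>.\<close>
  define R where "R = 1 + (\<Sum>j<n. cmod (a j) + cmod (c j))"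
  have R: "R \<ge> 1" unfolding R_def by (simp add: sum_nonneg)
  define L where "L = (\<Sum>j<n. cmod (c j) * (real (Suc j) * R) * R ^ j)"
  have L: "L \<ge> 0" unfolding L_def using R by (intro sum_nonneg mult_nonneg_nonneg) auto
  show ?thesis
  proof (intro exI[of _ "1 + L / m"] conjI allI impI)
    show "1 + L / m > 0" using L m by (intro add_pos_nonneg) auto
    fix \<sigma> :: real and s :: complex
    assume \<sigma>: "\<sigma> > 1 + L / m"
    define H where "H = of_real \<sigma> / (s + of_real \<sigma>)"
    assume "s ^ n = (\<Sum>j<n. (a j + c j * (of_real \<sigma> / (s + of_real \<sigma>)) ^ Suc j) * s ^ j)"
    then have eq: "s ^ n = (\<Sum>j<n. (a j + c j * H ^ Suc j) * s ^ j)" unfolding H_def .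
    have \<sigma>0: "\<sigma> > 0" using \<sigma> L m by (smt (verit) divide_nonneg_pos)
    have \<sigma>L: "L / \<sigma> < m"
    proof -
      have "L / m < \<sigma>" using \<sigma> by simp
      then show ?thesis using m \<sigma>0 by (simp add: field_simps)
    qed
    show "Re s < 0"
    proof (rule ccontr)
      assume "\<not> Re s < 0"
      then have s: "Re s \<ge> 0" by simp
      have ge: "\<sigma> \<le> cmod (s + of_real \<sigma>)"
        using complex_Re_le_cmod[of "s + of_real \<sigma>"] s by simp
      then have nz: "s + of_real \<sigma> \<noteq> 0" using \<sigma>0 by auto
      have H1: "cmod H \<le> 1"
        unfolding H_def norm_divide using ge \<sigma>0 by (simp add: divide_le_eq_1)
      have "cmod (a j + c j * H ^ Suc j) \<le> cmod (a j) + cmod (c j)" for j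
      proof -
        have "cmod (c j * H ^ Suc j) \<le> cmod (c j) * 1"
          unfolding norm_mult norm_power using H1 by (intro mult_left_mono power_le_one) auto
        then show ?thesis by (intro norm_triangle_le) simp
      qed
      then have sR: "cmod s \<le> R" unfolding R_def by (intro root_of_monic_norm_le[OF assms(1) eq])
      have "H - 1 = - s / (s + of_real \<sigma>)" unfolding H_def using nz by (simp add: field_simps)
      then have "cmod (H - 1) = cmod s / cmod (s + of_real \<sigma>)" by (simp add: norm_divide)
      also have "\<dots> \<le> R / \<sigma>" using sR ge \<sigma>0 R by (intro frac_le) auto
      finally have HR: "cmod (H - 1) \<le> R / \<sigma>" .
      \<comment> \<open>Both \<open>H\<close> and 1 lie in the closed unit disc, so taking powers
        magnifies their distance at most by the exponent.\<close>
      have pow: "cmod (H ^ i - 1) \<le> real i * (R / \<sigma>)" for i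
      proof -
        have "cmod (H ^ i - 1 ^ i) \<le> real i * cmod (H - 1)" using H1 by (intro norm_power_diff) auto
        also have "\<dots> \<le> real i * (R / \<sigma>)" using HR by (intro mult_left_mono) auto
        finally show ?thesis by simp
      qed
      \<comment> \<open>Replacing \<open>s ^ n\<close> by the filtered equation cancels the
        \<open>a j\<close> and leaves only the change in the feedback gains.\<close>
      have "poly p s = (\<Sum>j<n. c j * (H ^ Suc j - 1) * s ^ j)"
        unfolding poly_p eq sum_subtractf[symmetric] by (intro sum.cong) (auto simp: algebra_simps)
      also have "cmod \<dots> \<le> (\<Sum>j<n. cmod (c j) * (real (Suc j) * (R / \<sigma>)) * R ^ j)"
      proof (intro sum_norm_le)
        fix j
        show "cmod (c j * (H ^ Suc j - 1) * s ^ j) \<le> cmod (c j) * (real (Suc j) * (R / \<sigma>)) * R ^ j"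
          unfolding norm_mult norm_power
          using R \<sigma>0 by (intro mult_mono mult_left_mono power_mono pow sR mult_nonneg_nonneg) auto
      qed
      also have "\<dots> = L / \<sigma>" unfolding L_def sum_divide_distrib by (intro sum.cong) auto
      finally have "cmod (poly p s) \<le> L / \<sigma>" .
      then show False using m(2)[OF s] \<sigma>L by simp
    qed
  qed
qed

section \<open>The closed loop as a matrix\<close>

text \<open>Reduces the block form to entries: \<open>Suc i < n\<close> marks the shift rows, absent
  for \<open>n = 1\<close>, and the remaining row \<open>n - 1\<close> carries the
  coefficients.\<close>

lemma controller_normal_form_entries:
  assumes "n \<ge> 1" "controller_normal_form n A B"
  obtains a b where "A \<in> carrier_mat n n" "B \<in> carrier_mat n 1"
    "\<And>i j. i < n \<Longrightarrow> j < n \<Longrightarrow> A $$ (i, j) = (if Suc i < n then if j = Suc i then 1 else 0 else a j)"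
    "\<And>i. i < n \<Longrightarrow> B $$ (i, 0) = (if Suc i < n then 0 else b)"
proof -
  obtain An Bn where An: "An \<in> carrier_mat 1 n"
    and A: "A = four_block_mat (0\<^sub>m (n - 1) 1) (1\<^sub>m (n - 1)) (0\<^sub>m 0 1) (0\<^sub>m 0 (n - 1)) @\<^sub>r An"
    and B: "B = 0\<^sub>m (n - 1) 1 @\<^sub>r mat 1 1 (\<lambda>_. Bn)"
    using assms(2) by (auto simp: controller_normal_form_def)
  show thesis
  proof (rule that[of "\<lambda>j. An $$ (0, j)" Bn])
    show "A \<in> carrier_mat n n" "B \<in> carrier_mat n 1"
      unfolding A B append_rows_def using assms(1) An by (auto intro!: carrier_matI)
    show "A $$ (i, j) = (if Suc i < n then if j = Suc i then 1 else 0 else An $$ (0, j))"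
      if "i < n" "j < n" for i j
      unfolding A append_rows_def using assms(1) An that by (auto simp: not_less less_Suc_eq_le)
    show "B $$ (i, 0) = (if Suc i < n then 0 else Bn)" if "i < n" for i
      unfolding B append_rows_def using assms(1) that by auto
  qed
qed

text \<open>Each level of the recursion multiplies the preceding right-hand side by
  \<open>\<sigma>\<close>; unrolling it exhibits the linear dependence on the state.\<close>

lemma dirty_derivative_eq:
  "dirty_derivative \<sigma> x xh i = \<sigma> ^ Suc i * x $ 0 - (\<Sum>j\<le>i. \<sigma> ^ (Suc i - j) * xh $ j)"
proof (induction i)
  case (Suc i)
  have "(\<Sum>j\<le>i. \<sigma> ^ (Suc (Suc i) - j) * xh $ j) = \<sigma> * (\<Sum>j\<le>i. \<sigma> ^ (Suc i - j) * xh $ j)"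
    unfolding sum_distrib_left by (intro sum.cong) (auto simp: Suc_diff_le)
  then show ?case
    unfolding dirty_derivative.simps Suc.IH sum.atMost_Suc by (simp add: algebra_simps)
qed (simp add: algebra_simps)

text \<open>The lower blocks are read off from \<open>dirty_derivative_eq\<close>: only the first
  plant state is measured, and each estimate depends on itself and its predecessors.\<close>

definition closed_loop_mat ::
    "nat \<Rightarrow> real mat \<Rightarrow> real mat \<Rightarrow> real mat \<Rightarrow> real \<Rightarrow> real mat" where
  "closed_loop_mat n A B K \<sigma> = four_block_mat A (B * K)
     (mat n n (\<lambda>(i, j). if j = 0 then \<sigma> ^ Suc i else 0))
     (mat n n (\<lambda>(i, j). if j \<le> i then - (\<sigma> ^ (Suc i - j)) else 0))"

lemma closed_loop_eq_mult_mat_vec: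
  assumes n: "n \<ge> 1" and A: "A \<in> carrier_mat n n" and B: "B \<in> carrier_mat n 1" and K: "K \<in> carrier_mat 1 n"
    and z: "z \<in> carrier_vec (2 * n)"
  shows "closed_loop n A B K \<sigma> z = closed_loop_mat n A B K \<sigma> *\<^sub>v z"
proof -
  define x xh where "x = vec_first z n" and "xh = vec_last z n"
  have x: "x \<in> carrier_vec n" and xh: "xh \<in> carrier_vec n" by (simp_all add: x_def xh_def)
  have zx: "z = x @\<^sub>v xh" using z by (simp add: x_def xh_def mult_2)
  define C where "C = mat n n (\<lambda>(i, j). if j = 0 then \<sigma> ^ Suc i else 0)"
  define D where "D = mat n n (\<lambda>(i, j). if j \<le> i then - (\<sigma> ^ (Suc i - j)) else 0)"
  have CD: "C \<in> carrier_mat n n" "D \<in> carrier_mat n n" by (simp_all add: C_def D_def)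
  have "vec n (dirty_derivative \<sigma> x xh) = C *\<^sub>v x + D *\<^sub>v xh"
  proof (rule eq_vecI)
    fix i assume "i < dim_vec (C *\<^sub>v x + D *\<^sub>v xh)"
    then have i: "i < n" using CD by simp
    have "(C *\<^sub>v x) $ i = (\<Sum>k<n. C $$ (i, k) * x $ k)" by (rule mult_mat_vec_index_sum[OF CD(1) x i])
    also have "\<dots> = (\<Sum>k\<in>{0}. C $$ (i, k) * x $ k)"
      using n i by (intro sum.mono_neutral_right) (auto simp: C_def)
    finally have Cx: "(C *\<^sub>v x) $ i = \<sigma> ^ Suc i * x $ 0" using n i by (simp add: C_def)
    have "(D *\<^sub>v xh) $ i = (\<Sum>k<n. D $$ (i, k) * xh $ k)" by (rule mult_mat_vec_index_sum[OF CD(2) xh i])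
    also have "\<dots> = (\<Sum>k\<le>i. D $$ (i, k) * xh $ k)"
      using i by (intro sum.mono_neutral_right) (auto simp: D_def)
    also have "\<dots> = (\<Sum>k\<le>i. - (\<sigma> ^ (Suc i - k) * xh $ k))"
      using i by (intro sum.cong) (auto simp: D_def)
    finally have Dxh: "(D *\<^sub>v xh) $ i = - (\<Sum>k\<le>i. \<sigma> ^ (Suc i - k) * xh $ k)"
      by (simp add: sum_negf)
    have "(C *\<^sub>v x + D *\<^sub>v xh) $ i = (C *\<^sub>v x) $ i + (D *\<^sub>v xh) $ i"
      using CD i by (intro index_add_vec) simp
    then show "vec n (dirty_derivative \<sigma> x xh) $ i = (C *\<^sub>v x + D *\<^sub>v xh) $ i"
      using i by (simp only: Cx Dxh index_vec dirty_derivative_eq)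
  qed (use CD in simp)
  moreover have "closed_loop_mat n A B K \<sigma> *\<^sub>v z = (A *\<^sub>v x + (B * K) *\<^sub>v xh) @\<^sub>v (C *\<^sub>v x + D *\<^sub>v xh)"
    unfolding closed_loop_mat_def C_def[symmetric] D_def[symmetric] zx
    using A B K CD x xh by (intro four_block_mat_mult_vec) auto
  ultimately show ?thesis
    by (simp add: closed_loop_def Let_def x_def xh_def)
qed

section \<open>Eigenvectors of the closed loop\<close>

lemma sum_lessThan_add_split:
  fixes f :: "nat \<Rightarrow> 'a :: comm_monoid_add"
  shows "(\<Sum>k<m + n. f k) = (\<Sum>k<m. f k) + (\<Sum>k<n. f (m + k))"
  by (induction n) (auto simp: add.assoc)

text \<open>Undoing the recursion, the bracket for index \<open>i\<close> equals
  \<open>s * y i\<close>, so the next equation reads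
  \<open>(s + \<sigma>) * y (Suc i) = \<sigma> * s * y i\<close>. Each later stage therefore
  contributes \<open>s * \<sigma> / (s + \<sigma>)\<close>, while the first contributes no
  \<open>s\<close>: hence \<open>s ^ i\<close> next to a filter power \<open>Suc i\<close>.\<close>

lemma cascade_eigen_equations:
  fixes x y :: "nat \<Rightarrow> complex"
  assumes x: "\<And>i. Suc i < n \<Longrightarrow> x (Suc i) = s * x i"
    and y: "\<And>i. i < n \<Longrightarrow> s * y i = \<sigma> ^ Suc i * x 0 - (\<Sum>j\<le>i. \<sigma> ^ (Suc i - j) * y j)"
    and nz: "s + \<sigma> \<noteq> 0"
    and i: "i < n"
  shows "x i = s ^ i * x 0" "y i = s ^ i * (\<sigma> / (s + \<sigma>)) ^ Suc i * x 0"
proof -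
  show "x i = s ^ i * x 0" using i
    by (induction i) (simp_all add: x)
  show "y i = s ^ i * (\<sigma> / (s + \<sigma>)) ^ Suc i * x 0" using i
  proof (induction i)
    case 0
    have "(s + \<sigma>) * y 0 = \<sigma> * x 0" using y[OF 0] by (simp add: algebra_simps)
    then show ?case using nz by (simp add: field_simps)
  next
    case (Suc i)
    have "(\<Sum>j\<le>i. \<sigma> ^ (Suc (Suc i) - j) * y j) = \<sigma> * (\<Sum>j\<le>i. \<sigma> ^ (Suc i - j) * y j)"
      unfolding sum_distrib_left by (intro sum.cong) (auto simp: Suc_diff_le)
    then have "s * y (Suc i) = \<sigma> * (\<sigma> ^ Suc i * x 0 - (\<Sum>j\<le>i. \<sigma> ^ (Suc i - j) * y j)) - \<sigma> * y (Suc i)"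
      using y[OF Suc.prems] by (simp add: algebra_simps)
    also have "\<sigma> ^ Suc i * x 0 - (\<Sum>j\<le>i. \<sigma> ^ (Suc i - j) * y j) = s * y i"
      using y[of i] Suc.prems by simp
    finally have "(s + \<sigma>) * y (Suc i) = \<sigma> * s * y i" by (simp add: algebra_simps)
    then have "y (Suc i) = \<sigma> / (s + \<sigma>) * s * y i" using nz by (simp add: field_simps)
    then show ?case using Suc by simp
  qed
qed

text \<open>The shift rows and the filter rows express the whole eigenvector through
  \<open>x 0\<close>; the last plant row then becomes the scalar equation. The value
  \<open>s = - \<sigma>\<close> is set aside because the filter factor has its pole there.\<close>

lemma closed_loop_mat_eigenvalue:
  assumes n: "n \<ge> 1" and A: "A \<in> carrier_mat n n" and B: "B \<in> carrier_mat n 1" and K: "K \<in> carrier_mat 1 n"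
    and Ai: "\<And>i j. i < n \<Longrightarrow> j < n \<Longrightarrow> A $$ (i, j) = (if Suc i < n then if j = Suc i then 1 else 0 else a j)"
    and BKi: "\<And>i j. i < n \<Longrightarrow> j < n \<Longrightarrow> (B * K) $$ (i, j) = (if Suc i < n then 0 else c j)"
    and ev: "eigenvalue (map_mat complex_of_real (closed_loop_mat n A B K \<sigma>)) s"
    and nz: "s + of_real \<sigma> \<noteq> 0"
  shows "s ^ n = (\<Sum>j<n. (of_real (a j) + of_real (c j) * (of_real \<sigma> / (s + of_real \<sigma>)) ^ Suc j) * s ^ j)"
proof -
  define M where "M = closed_loop_mat n A B K \<sigma>"
  have M: "M \<in> carrier_mat (n + n) (n + n)" unfolding M_def closed_loop_mat_def using A by auto
  obtain v where v: "v \<in> carrier_vec (n + n)" "v \<noteq> 0\<^sub>v (n + n)"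
    and Mv: "map_mat complex_of_real M *\<^sub>v v = s \<cdot>\<^sub>v v"
    using ev M unfolding M_def[symmetric] by (auto simp: eigenvalue_def eigenvector_def)
  define x y where "x i = v $ i" and "y i = v $ (n + i)" for i
  have row_eq: "(\<Sum>k<n. of_real (M $$ (i, k)) * x k) + (\<Sum>k<n. of_real (M $$ (i, n + k)) * y k) = s * v $ i"
    if i: "i < n + n" for i
  proof -
    have "s * v $ i = (map_mat complex_of_real M *\<^sub>v v) $ i" unfolding Mv using v(1) i by simp
    also have "\<dots> = (\<Sum>k<n + n. map_mat complex_of_real M $$ (i, k) * v $ k)"
      using M v(1) i by (intro mult_mat_vec_index_sum) auto
    also have "\<dots> = (\<Sum>k<n + n. of_real (M $$ (i, k)) * v $ k)"
      using M i by (intro sum.cong) auto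
    finally show ?thesis unfolding sum_lessThan_add_split x_def y_def by simp
  qed
  have M11: "M $$ (i, j) = A $$ (i, j)" and M12: "M $$ (i, n + j) = (B * K) $$ (i, j)"
    and M21: "M $$ (n + i, j) = (if j = 0 then \<sigma> ^ Suc i else 0)"
    and M22: "M $$ (n + i, n + j) = (if j \<le> i then - (\<sigma> ^ (Suc i - j)) else 0)"
    if "i < n" "j < n" for i j
    unfolding M_def closed_loop_mat_def using that A B K by (simp_all del: index_mult_mat(1))
  have xs: "x (Suc i) = s * x i" if i: "Suc i < n" for i
  proof -
    have i': "i < n" using i by simp
    have "(\<Sum>k<n. of_real (M $$ (i, n + k)) * y k) = 0"
      using i i' by (intro sum.neutral) (simp add: M12 BKi del: index_mult_mat(1))
    moreover have "(\<Sum>k<n. of_real (M $$ (i, k)) * x k) = (\<Sum>k\<in>{Suc i}. of_real (M $$ (i, k)) * x k)"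
      using i i' by (intro sum.mono_neutral_right) (auto simp: M11 Ai)
    moreover have "\<dots> = x (Suc i)" using i i' by (simp add: M11 Ai)
    ultimately have "x (Suc i) + 0 = s * v $ i" using row_eq[of i] i' by simp
    then show ?thesis by (simp add: x_def)
  qed
  have last_row: "(\<Sum>k<n. of_real (a k) * x k) + (\<Sum>k<n. of_real (c k) * y k) = s * x (n - 1)"
  proof -
    have "(\<Sum>k<n. of_real (M $$ (n - 1, k)) * x k) = (\<Sum>k<n. of_real (a k) * x k)"
      using n by (intro sum.cong) (auto simp: M11 Ai)
    moreover have "(\<Sum>k<n. of_real (M $$ (n - 1, n + k)) * y k) = (\<Sum>k<n. of_real (c k) * y k)"
      using n by (intro sum.cong) (auto simp: M12 BKi simp del: index_mult_mat(1))
    ultimately show ?thesis using row_eq[of "n - 1"] n by (simp add: x_def)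
  qed
  have ys: "s * y i = of_real \<sigma> ^ Suc i * x 0 - (\<Sum>j\<le>i. of_real \<sigma> ^ (Suc i - j) * y j)" if i: "i < n" for i
  proof -
    have "(\<Sum>k<n. of_real (M $$ (n + i, k)) * x k) = (\<Sum>k\<in>{0}. of_real (M $$ (n + i, k)) * x k)"
      using i n by (intro sum.mono_neutral_right) (auto simp: M21)
    moreover have "\<dots> = of_real \<sigma> ^ Suc i * x 0" using i n by (simp add: M21)
    moreover have "(\<Sum>k<n. of_real (M $$ (n + i, n + k)) * y k) = (\<Sum>k\<le>i. of_real (M $$ (n + i, n + k)) * y k)"
      using i by (intro sum.mono_neutral_right) (auto simp: M22)
    moreover have "\<dots> = (\<Sum>j\<le>i. - (of_real \<sigma> ^ (Suc i - j) * y j))"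
      using i by (intro sum.cong) (auto simp: M22)
    ultimately show ?thesis using row_eq[of "n + i"] i by (simp add: y_def sum_negf)
  qed
  have sol: "x i = s ^ i * x 0" "y i = s ^ i * (of_real \<sigma> / (s + of_real \<sigma>)) ^ Suc i * x 0"
    if "i < n" for i
    using cascade_eigen_equations[of n x s y "of_real \<sigma>" i] xs ys nz that by blast+
  \<comment> \<open>If \<open>x 0\<close> vanished, the cascade would make every entry of the
    eigenvector zero, so \<open>x 0\<close> may be cancelled at the end.\<close>
  have x0: "x 0 \<noteq> 0"
  proof
    assume x0: "x 0 = 0"
    have "v $ i = 0" if "i < n + n" for i
    proof (cases "i < n")
      case True
      then show ?thesis using sol(1)[of i] x0 by (simp add: x_def)
    next
      case False
      then show ?thesis using sol(2)[of "i - n"] x0 that by (simp add: y_def)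
    qed
    then have "v = 0\<^sub>v (n + n)" using v(1) by (intro eq_vecI) auto
    then show False using v(2) by simp
  qed
  have "s ^ n * x 0 = s * x (n - 1)"
    using sol(1)[of "n - 1"] n by (simp flip: power_Suc mult.assoc)
  also have "\<dots> = (\<Sum>j<n. of_real (a j) * x j + of_real (c j) * y j)"
    unfolding last_row[symmetric] sum.distrib ..
  also have "\<dots> = (\<Sum>j<n. (of_real (a j) + of_real (c j) * (of_real \<sigma> / (s + of_real \<sigma>)) ^ Suc j) * s ^ j) * x 0"
    unfolding sum_distrib_right
  proof (intro sum.cong refl)
    fix j assume "j \<in> {..<n}"
    then have j: "j < n" by simp
    show "of_real (a j) * x j + of_real (c j) * y j
      = (of_real (a j) + of_real (c j) * (of_real \<sigma> / (s + of_real \<sigma>)) ^ Suc j) * s ^ j * x 0"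
      unfolding sol(1)[OF j] sol(2)[OF j] by (simp only: algebra_simps)
  qed
  finally show ?thesis using x0 by simp
qed

text \<open>The vector of powers \<open>s ^ i\<close> is an eigenvector: shift rows raise the power
  by one, and the last row does so by the root equation. Entry 0 equals 1, so it is nonzero.\<close>

lemma companion_eigenvalue:
  fixes F :: "'a :: field mat"
  assumes n: "n \<ge> 1" and F: "F \<in> carrier_mat n n"
    and Fi: "\<And>i j. i < n \<Longrightarrow> j < n \<Longrightarrow> F $$ (i, j) = (if Suc i < n then if j = Suc i then 1 else 0 else f j)"
    and root: "s ^ n = (\<Sum>j<n. f j * s ^ j)"
  shows "eigenvalue F s"
proof -
  define v where "v = vec n (\<lambda>i. s ^ i)"
  have v: "v \<in> carrier_vec n" by (simp add: v_def)
  have "F *\<^sub>v v = s \<cdot>\<^sub>v v"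
  proof (rule eq_vecI)
    fix i assume "i < dim_vec (s \<cdot>\<^sub>v v)"
    then have i: "i < n" by (simp add: v_def)
    have "(F *\<^sub>v v) $ i = (\<Sum>k<n. F $$ (i, k) * v $ k)" by (rule mult_mat_vec_index_sum[OF F v i])
    also have "\<dots> = s ^ Suc i"
    proof (cases "Suc i < n")
      case True
      have "(\<Sum>k<n. F $$ (i, k) * v $ k) = (\<Sum>k\<in>{Suc i}. F $$ (i, k) * v $ k)"
        using True by (intro sum.mono_neutral_right) (auto simp: Fi)
      then show ?thesis using True by (simp add: Fi v_def)
    next
      case False
      then have n_eq: "Suc i = n" using i by simp
      have "(\<Sum>k<n. F $$ (i, k) * v $ k) = (\<Sum>k<n. f k * s ^ k)"
        using i False by (intro sum.cong) (auto simp: Fi v_def)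
      then show ?thesis by (simp only: root[symmetric] n_eq)
    qed
    finally show "(F *\<^sub>v v) $ i = (s \<cdot>\<^sub>v v) $ i" using i by (simp add: v_def)
  qed (use F in \<open>simp add: v_def\<close>)
  moreover have "v \<noteq> 0\<^sub>v n"
  proof
    assume "v = 0\<^sub>v n"
    then have "v $ 0 = 0" using n by simp
    then show False using n by (simp add: v_def)
  qed
  ultimately show ?thesis using F v by (auto simp: eigenvalue_def eigenvector_def)
qed

section \<open>Assembly of the stability theorem\<close>

text \<open>Solutions stay in \<open>carrier_vec m\<close> for nonnegative times, so only values of
  the vector field there matter. This suits \<open>closed_loop\<close>, whose matrix form is
  established just for vectors of dimension \<open>2 * n\<close>.\<close>

lemma asymptotically_stable_cong:
  assumes "\<And>z. z \<in> carrier_vec m \<Longrightarrow> f z = g z"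
  shows "asymptotically_stable m f \<longleftrightarrow> asymptotically_stable m g"
proof -
  have "is_solution m f = is_solution m g"
    using assms by (auto simp: is_solution_def fun_eq_iff)
  then show ?thesis by (simp add: asymptotically_stable_def)
qed

theorem theorem4p2:
  fixes n :: nat and A B K :: "real mat"
  assumes "n \<ge> 1"
    and "controller_normal_form n A B"
    and "K \<in> carrier_mat 1 n"
    and "\<exists>P Q. sym_pos_def n P \<and> sym_pos_def n Q \<and>
           (A + B * K)\<^sup>T * P + P * (A + B * K) = - Q"
  shows "\<exists>\<sigma>\<^sub>0::real. \<sigma>\<^sub>0 > 0 \<and>
           (\<forall>\<sigma>>\<sigma>\<^sub>0. asymptotically_stable (2 * n) (closed_loop n A B K \<sigma>))"
proof -
  obtain a b where A: "A \<in> carrier_mat n n" and B: "B \<in> carrier_mat n 1"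
    and Ai: "\<And>i j. i < n \<Longrightarrow> j < n \<Longrightarrow> A $$ (i, j) = (if Suc i < n then if j = Suc i then 1 else 0 else a j)"
    and Bi: "\<And>i. i < n \<Longrightarrow> B $$ (i, 0) = (if Suc i < n then 0 else b)"
    using controller_normal_form_entries[OF assms(1,2)] by metis
  \<comment> \<open>The last row of \<open>B * K\<close>. It is kept apart from the last row
    \<open>a\<close> of \<open>A\<close> because only the feedback acts through the filters.\<close>
  define c where "c j = b * K $$ (0, j)" for j
  have BKi: "(B * K) $$ (i, j) = (if Suc i < n then 0 else c j)" if "i < n" "j < n" for i j
    using that B assms(3) Bi[OF that(1)] by (auto simp: scalar_prod_def c_def)
  have F: "A + B * K \<in> carrier_mat n n" using A B assms(3) by auto
  have BK: "B * K \<in> carrier_mat n n" using B assms(3) by auto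
  \<comment> \<open>\<open>A + B * K\<close> is again a companion matrix, so every root of the
    unfiltered equation is one of its eigenvalues and the Lyapunov equation applies.\<close>
  have nominal: "Re s < 0" if "s ^ n = (\<Sum>j<n. (of_real (a j) + of_real (c j)) * s ^ j)" for s
  proof -
    have "eigenvalue (map_mat complex_of_real (A + B * K)) s"
    proof (rule companion_eigenvalue[OF assms(1) _ _ that])
      show "map_mat complex_of_real (A + B * K) $$ (i, j)
        = (if Suc i < n then if j = Suc i then 1 else 0 else of_real (a j) + of_real (c j))"
        if ij: "i < n" "j < n" for i j
      proof -
        have "map_mat complex_of_real (A + B * K) $$ (i, j) = of_real ((A + B * K) $$ (i, j))"
          using F ij by (intro index_map_mat) (auto simp del: index_add_mat)
        also have "(A + B * K) $$ (i, j) = A $$ (i, j) + (B * K) $$ (i, j)"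
          using BK ij by (intro index_add_mat) auto
        finally show ?thesis using ij by (simp add: Ai BKi del: index_mult_mat(1))
      qed
    qed (use F in auto)
    then show ?thesis using assms(4) lyapunov_equation_imp_hurwitz[OF F] by blast
  qed
  obtain \<sigma>\<^sub>0 where \<sigma>0: "\<sigma>\<^sub>0 > 0" and stable: "\<And>\<sigma> s. \<sigma> > \<sigma>\<^sub>0 \<Longrightarrow>
      s ^ n = (\<Sum>j<n. (of_real (a j) + of_real (c j) * (of_real \<sigma> / (s + of_real \<sigma>)) ^ Suc j) * s ^ j)
      \<Longrightarrow> Re s < 0"
    using filtered_characteristic_equation_stable[OF assms(1),
        of "\<lambda>j. of_real (a j)" "\<lambda>j. of_real (c j)"] nominal by blast
  have "asymptotically_stable (2 * n) (closed_loop n A B K \<sigma>)" if \<sigma>: "\<sigma> > \<sigma>\<^sub>0" for \<sigma>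
  proof -
    have "asymptotically_stable (2 * n) (\<lambda>z. closed_loop_mat n A B K \<sigma> *\<^sub>v z)"
    proof (rule hurwitz_imp_asymptotically_stable)
      show "closed_loop_mat n A B K \<sigma> \<in> carrier_mat (2 * n) (2 * n)"
        unfolding closed_loop_mat_def mult_2 using A by auto
      fix s assume ev: "eigenvalue (map_mat complex_of_real (closed_loop_mat n A B K \<sigma>)) s"
      show "Re s < 0"
      \<comment> \<open>At the pole of the filter factor the eigenvalue is
        \<open>- \<sigma>\<close>, which is already negative.\<close>
      proof (cases "s + of_real \<sigma> = 0")
        case True
        then have "s = - of_real \<sigma>" by (simp add: add_eq_0_iff2)
        then show ?thesis using \<sigma> \<sigma>0 by simp
      next
        case False
        show ?thesis
          by (rule stable[OF \<sigma> closed_loop_mat_eigenvalue[OF assms(1) A B assms(3) Ai BKi ev False]])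
      qed
    qed
    then show ?thesis
      using asymptotically_stable_cong[of "2 * n" "closed_loop n A B K \<sigma>"
          "(*\<^sub>v) (closed_loop_mat n A B K \<sigma>)"]
        closed_loop_eq_mult_mat_vec[OF assms(1) A B assms(3)] by blast
  qed
  then show ?thesis using \<sigma>0 by blast
qed

end
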